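(* Suppose $X$ is a locally compact separable metrizable space and $h:X\to X$ is a homeomorphism. Then $h$ is compactly almost periodic if and only if there exists a metric $d$ on $X$ such that $h$ is an almost periodic homeomorphism of $(X,d)$.
   Context: All metrics on a metrizable space $X$ are required to induce the given topology of $X$. A homeomorphism $h$ of a metric space $(X,d)$ is almost periodic if for each $\varepsilon>0$ there is an integer $N\ge 0$ such that for every $M\in\mathbb{Z}$ there is an integer $i$ with $M\le i\le M+N$ and $d(h^{i}(x),x)<\varepsilon$ for all $x\in X$. A homeomorphism $h$ of a metrizable space $X$ is compactly almost periodic if (i) $\overline{\bigcup_{n\in\mathbb{Z}}h^{n}(B)}$ is compact for each compact $B\subset X$, and (ii) for each compact $A\subset X$ with $h(A)=A$, the restriction $h|_{A}:A\to A$ is an almost periodic homeomorphism of $A$ (with respect to a metric on $A$ inducing its topology; since $A$ is compact the choice of metric is immaterial). *)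

theory Defs
  imports "HOL-Analysis.Analysis"
begin

(* The i-th iterate of a bijection h of the set S onto itself, for an integer i.
   It is only meaningful on points of S, where it depends only on the values of h on S;
   so iterate A h is the iterate of the restriction of h to A. *)
definition iterate :: "'a set \<Rightarrow> ('a \<Rightarrow> 'a) \<Rightarrow> int \<Rightarrow> 'a \<Rightarrow> 'a" where
  "iterate S h i = (if 0 \<le> i then h ^^ nat i else inv_into S h ^^ nat (- i))"

definition almost_periodic_homeo :: "'a set \<Rightarrow> ('a \<Rightarrow> 'a \<Rightarrow> real) \<Rightarrow> ('a \<Rightarrow> 'a) \<Rightarrow> bool" where
  "almost_periodic_homeo S d h \<longleftrightarrow>
     Metric_space S d \<and>
     homeomorphic_map (Metric_space.mtopology S d) (Metric_space.mtopology S d) h \<and>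
     (\<forall>\<epsilon>>0. \<exists>N::int. 0 \<le> N \<and>
        (\<forall>M::int. \<exists>i. M \<le> i \<and> i \<le> M + N \<and> (\<forall>x\<in>S. d (iterate S h i x) x < \<epsilon>)))"

definition metric_inducing :: "'a topology \<Rightarrow> ('a \<Rightarrow> 'a \<Rightarrow> real) \<Rightarrow> bool" where
  "metric_inducing X d \<longleftrightarrow>
     Metric_space (topspace X) d \<and> Metric_space.mtopology (topspace X) d = X"

(* In the last clause, topspace (subtopology X A) = A, since compactin X A gives A \<subseteq> topspace X.
   The choice of the metric on A is immaterial because A is compact. *)
definition compactly_almost_periodic :: "'a topology \<Rightarrow> ('a \<Rightarrow> 'a) \<Rightarrow> bool" where
  "compactly_almost_periodic X h \<longleftrightarrow>
     metrizable_space X \<and> homeomorphic_map X X h \<and>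
     (\<forall>B. compactin X B \<longrightarrow>
        compactin X (X closure_of (\<Union>n. iterate (topspace X) h n ` B))) \<and>
     (\<forall>A. compactin X A \<and> h ` A = A \<longrightarrow>
        (\<exists>d. metric_inducing (subtopology X A) d \<and> almost_periodic_homeo A d h))"

end

theory Submission
  imports Defs
begin

text \<open>
  Almost periodicity on compact invariant sets is insensitive to the metric, so a metric on
  \<open>X\<close> has to be found that makes the return times uniform near infinity. It suffices that the
  metric extends to the one-point compactification, that is, that it is small off compact
  sets: given \<open>\<epsilon>\<close>, the complement of some compact set has diameter below \<open>\<epsilon>\<close>, and as orbit
  closures of compact sets are compact, that compact set may be enlarged to a compact set \<open>K\<close> with \<open>h ` K = K\<close>. A point off \<open>K\<close>
  stays off \<open>K\<close>, so all iterates move it by less than \<open>\<epsilon>\<close>, and the return times of \<open>h\<close> on \<open>K\<close>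
  serve all of \<open>X\<close> (\<open>compactly_almost_periodic_imp_almost_periodic\<close>). Such a metric is obtained
  in \<open>metric_small_outside_compacta\<close> by writing it down, without constructing the
  compactification: take any metric \<open>\<rho>\<close> and let points also travel through infinity, at cost
  \<open>f x + f y\<close>, where \<open>f\<close> is positive, 1-Lipschitz and vanishes at infinity.

  Conversely, let \<open>h\<close> be almost periodic for \<open>d\<close> and let \<open>B\<close> be compact. Some \<open>r\<close>-neighbourhood of
  \<open>B\<close> lies in a compact set \<open>K\<close>. Every integer \<open>n\<close> is \<open>i + j\<close>, where \<open>h\<close> iterated \<open>i\<close> times moves
  points by less than \<open>r\<close> and \<open>0 \<le> j \<le> N\<close>. Hence the orbit of \<open>B\<close> lies in the union of the
  finitely many compact sets \<open>(h ^^ j) ` K\<close> (\<open>almost_periodic_orbit_closure_compact\<close>).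
\<close>

section \<open>Iterates of a bijection\<close>

lemma iterate_zero [simp]: "iterate S h 0 x = x"
  by (simp add: iterate_def)

lemma iterate_mem:
  assumes "bij_betw h S S" "x \<in> S"
  shows "iterate S h i x \<in> S"
proof -
  have closed_under_funpow: "(g ^^ n) x \<in> S" if "g ` S = S" for g :: "'a \<Rightarrow> 'a" and n :: nat
    using that assms(2) by (induction n) auto
  have "h ` S = S" "inv_into S h ` S = S"
    using assms(1) bij_betw_inv_into[OF assms(1)] by (auto simp: bij_betw_def)
  then show ?thesis
    by (simp add: iterate_def closed_under_funpow)
qed

lemma iterate_succ:
  assumes "bij_betw h S S" "x \<in> S"
  shows "iterate S h (i + 1) x = h (iterate S h i x)"
proof (cases "0 \<le> i")
  case True
  then show ?thesis
    by (simp add: iterate_def nat_add_distrib)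
next
  case False
  define n where "n = nat (- i - 1)"
  have i: "i = - int (Suc n)"
    using False by (simp add: n_def)
  have pred: "iterate S h i x = inv_into S h (iterate S h (i + 1) x)"
    unfolding i by (cases n) (simp_all add: iterate_def nat_add_distrib)
  have "iterate S h (i + 1) x \<in> h ` S"
    using iterate_mem[OF assms] assms(1) by (simp add: bij_betw_def)
  then show ?thesis
    by (simp add: pred f_inv_into_f)
qed

lemma iterate_add_nat:
  assumes "bij_betw h S S" "x \<in> S"
  shows "iterate S h (i + int j) x = (h ^^ j) (iterate S h i x)"
proof (induction j)
  case (Suc j)
  have "iterate S h (i + int (Suc j)) x = iterate S h ((i + int j) + 1) x"
    by (simp add: algebra_simps)
  then show ?case
    by (simp only: iterate_succ[OF assms] Suc funpow.simps o_apply)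
qed simp

lemma iterate_restrict:
  assumes "bij_betw h S S" "A \<subseteq> S" "h ` A = A" "x \<in> A"
  shows "iterate A h i x = iterate S h i x"
proof -
  have A: "bij_betw h A A"
    using bij_betw_subset[OF assms(1-3)] .
  have inv: "inv_into A h y = inv_into S h y" if "y \<in> A" for y
  proof -
    have "inv_into A h y \<in> A" "h (inv_into A h y) = y"
      using that assms(3) by (simp_all add: inv_into_into f_inv_into_f)
    then show ?thesis
      using assms(1,2) inv_into_f_f[of h S "inv_into A h y"] by (auto simp: bij_betw_def)
  qed
  have "(inv_into A h ^^ n) x = (inv_into S h ^^ n) x \<and> (inv_into A h ^^ n) x \<in> A" for n
    using assms(3,4) inv by (induction n) (auto intro: inv_into_into)
  then show ?thesis
    by (simp add: iterate_def)
qed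

section \<open>Compact neighbourhoods\<close>

context Metric_space
begin

lemma compactin_mcball_mono:
  assumes "compactin mtopology (mcball x r)" "mcball y s \<subseteq> mcball x r"
  shows "compactin mtopology (mcball y s)"
  using assms closed_compactin closedin_mcball by blast

lemma locally_compact_obtain_compact_mcball:
  assumes "locally_compact_space mtopology" "x \<in> M"
  obtains r where "0 < r" "compactin mtopology (mcball x r)"
proof -
  obtain U K where UK: "openin mtopology U" "compactin mtopology K" "x \<in> U" "U \<subseteq> K"
    using assms unfolding locally_compact_space_def by auto
  obtain r where "0 < r" "mcball x r \<subseteq> U"
    using UK by (meson openin_mtopology_mcball)
  then show thesis
    using UK that closed_compactin closedin_mcball by (meson order_trans)
qed

text \<open>
  Around each point of \<open>B\<close> there is a compact ball of radius \<open>2 * r x\<close>. Finitely many of the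
  balls of half that radius cover \<open>B\<close>, and the smallest of these half radii is a common
  distance that keeps within the union of the full balls.
\<close>

lemma locally_compact_obtain_uniform_nbhd:
  assumes lc: "locally_compact_space mtopology" and B: "compactin mtopology B"
  obtains r K where "0 < r" "compactin mtopology K"
    "\<And>x y. \<lbrakk>x \<in> B; y \<in> M; d x y < r\<rbrakk> \<Longrightarrow> y \<in> K"
proof -
  have "\<exists>r>0. compactin mtopology (mcball x (2 * r))" if "x \<in> B" for x
  proof -
    have "x \<in> M"
      using B that compactin_subset_topspace by fastforce
    then obtain r where "0 < r" "compactin mtopology (mcball x r)"
      using lc locally_compact_obtain_compact_mcball by blast
    then show ?thesis
      by (intro exI[of _ "r/2"]) simp
  qed
  then obtain r where r: "\<forall>x\<in>B. 0 < r x \<and> compactin mtopology (mcball x (2 * r x))"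
    using bchoice[of B "\<lambda>x r. 0 < r \<and> compactin mtopology (mcball x (2 * r))"] by blast
  have BM: "B \<subseteq> M"
    using B compactin_subset_topspace by fastforce
  have "B \<subseteq> \<Union> ((\<lambda>x. mball x (r x)) ` B)"
    using BM r by force
  then obtain F where F: "finite F" "F \<subseteq> (\<lambda>x. mball x (r x)) ` B" "B \<subseteq> \<Union> F"
    using compactinD[OF B, of "(\<lambda>x. mball x (r x)) ` B"] by blast
  obtain C where C: "finite C" "C \<subseteq> B" "B \<subseteq> (\<Union>x\<in>C. mball x (r x))"
    using finite_subset_image[OF F(1,2)] F(3) by auto
  define e where "e = Min (insert 1 (r ` C))"
  have e: "0 < e" "\<And>x. x \<in> C \<Longrightarrow> e \<le> r x"
    using C r by (auto simp: e_def)
  show thesis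
  proof
    show "compactin mtopology (\<Union>x\<in>C. mcball x (2 * r x))"
      using C r by (intro compactin_Union) auto
    fix x y assume xy: "x \<in> B" "y \<in> M" "d x y < e"
    then obtain c where c: "c \<in> C" "c \<in> M" "x \<in> M" "d c x < r c"
      using C by auto
    then have "d c y \<le> 2 * r c"
      using triangle[of c x y] xy e(2)[of c] by auto
    then show "y \<in> (\<Union>x\<in>C. mcball x (2 * r x))"
      using c xy by auto
  qed (use e in auto)
qed

text \<open>
  The quantitative form of \<open>\<sigma>\<close>-compactness. Balls, rather than arbitrary compact sets, are
  wanted because the distance to the centre yields Lipschitz bump functions.
\<close>

lemma countable_cover_by_compact_balls:
  assumes lc: "locally_compact_space mtopology" and sep: "separable_space mtopology"
  obtains c :: "nat \<Rightarrow> 'a" and r :: "nat \<Rightarrow> real"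
  where "\<And>n. compactin mtopology (mcball (c n) (r n))"
    "\<And>x. x \<in> M \<Longrightarrow> \<exists>n. x \<in> mball (c n) (r n)"
proof -
  obtain D where D: "countable D" "D \<subseteq> M" "mtopology closure_of D = M"
    using sep by (auto simp: separable_space_def)
  (* centres in D and radii of the form 1 / k make the family countable; the empty ball
     (undefined, -1) is added so that it can be enumerated even when M is empty *)
  define I where "I = {p \<in> D \<times> range (\<lambda>k::nat. 1 / real (Suc k)).
      compactin mtopology (mcball (fst p) (snd p))}"
  have I: "countable (insert (undefined, -1) I)"
    using D(1) by (auto simp: I_def)
  define p where "p = from_nat_into (insert (undefined, -1) I)"
  have range_p: "range p = insert (undefined, -1) I"
    unfolding p_def using I by (intro range_from_nat_into) auto
  show thesis
  proof
    fix n
    have "p n \<in> insert (undefined, -1) I"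
      using range_p by blast
    moreover have "mcball (undefined::'a) (-1) = {}"
      by (simp add: mcball_eq_empty)
    ultimately show "compactin mtopology (mcball ((fst \<circ> p) n) ((snd \<circ> p) n))"
      by (auto simp: I_def)
  next
    fix x assume x: "x \<in> M"
    obtain R where R: "0 < R" "compactin mtopology (mcball x R)"
      using lc x by (rule locally_compact_obtain_compact_mcball)
    obtain k where k: "1 / real (Suc k) < R / 2"
      using R(1) reals_Archimedean[of "R / 2"] by (auto simp: inverse_eq_divide)
    let ?s = "1 / real (Suc k)"
    have "\<forall>r>0. \<exists>y\<in>D. y \<in> mball x r"
      using D(3) x unfolding metric_closure_of by blast
    moreover have "0 < ?s"
      by simp
    ultimately obtain y where y: "y \<in> D" "y \<in> mball x ?s"
      by blast
    have "mcball y ?s \<subseteq> mcball x R"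
    proof
      fix z assume "z \<in> mcball y ?s"
      then show "z \<in> mcball x R"
        using y k triangle[of x y z] by auto
    qed
    then have "(y, ?s) \<in> I"
      using R(2) y by (auto simp: I_def intro: compactin_mcball_mono)
    then obtain n where "p n = (y, ?s)"
      using range_p by (metis insertCI rangeE)
    then show "\<exists>n. x \<in> mball ((fst \<circ> p) n) ((snd \<circ> p) n)"
      using y by (intro exI[of _ n]) (auto simp: commute)
  qed
qed

section \<open>Metrics whose diameter is small outside a compact set\<close>

text \<open>
  The function is a supremum of bumps on compact balls that cover the space. Bounds and
  Lipschitz constants pass to suprema without any question of convergence.
\<close>

lemma Lipschitz_function_vanishing_at_infinity:
  assumes "locally_compact_space mtopology" "separable_space mtopology"
  obtains f :: "'a \<Rightarrow> real"
  where "\<And>x. 0 \<le> f x" "\<And>x. x \<in> M \<Longrightarrow> 0 < f x"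
    "\<And>x y. \<lbrakk>x \<in> M; y \<in> M\<rbrakk> \<Longrightarrow> f x \<le> f y + d x y"
    "\<And>\<epsilon>. 0 < \<epsilon> \<Longrightarrow> \<exists>K. compactin mtopology K \<and> (\<forall>x\<in>M - K. f x < \<epsilon>)"
proof -
  obtain c :: "nat \<Rightarrow> 'a" and r :: "nat \<Rightarrow> real"
    where compact: "\<And>n. compactin mtopology (mcball (c n) (r n))"
      and cover: "\<And>x. x \<in> M \<Longrightarrow> \<exists>n. x \<in> mball (c n) (r n)"
    using countable_cover_by_compact_balls[OF assms] by metis
  (* g n is a bump on the n-th ball; its cap (1/2)^n makes the supremum small wherever the first
     bumps vanish. The centre c n may lie outside M, where d need not satisfy the triangle inequality. *)
  define g where "g n x = (if c n \<in> M then max 0 (min ((1/2) ^ n) (r n - d (c n) x)) else 0)"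
    for n x
  define f where "f x = (SUP n. g n x)" for x
  have g_nonneg: "0 \<le> g n x" and g_le: "g n x \<le> (1/2) ^ n" for n x
    by (auto simp: g_def)
  have g_le_1: "g n x \<le> 1" for n x
    using g_le[of n x] power_le_one[of "1/2::real" n] by linarith
  have bdd: "bdd_above (range (\<lambda>n. g n x))" for x
    using g_le_1 by (auto intro!: bdd_aboveI)
  have g_le_f: "g n x \<le> f x" for n x
    unfolding f_def by (rule cSUP_upper[OF _ bdd]) simp
  show thesis
  proof
    show "0 \<le> f x" for x
      using g_nonneg[of 0 x] g_le_f[of 0 x] by linarith
    show "0 < f x" if "x \<in> M" for x
    proof -
      obtain n where "x \<in> mball (c n) (r n)"
        using cover[OF \<open>x \<in> M\<close>] by blast
      then have "0 < g n x"
        by (auto simp: g_def)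
      then show ?thesis
        using g_le_f[of n x] by linarith
    qed
    show "f x \<le> f y + d x y" if "x \<in> M" "y \<in> M" for x y
    proof -
      have "g n x \<le> g n y + d x y" for n
        using triangle[of "c n" x y] that
        by (auto simp: g_def min_def max_def intro: add_increasing2)
      then have "g n x \<le> f y + d x y" for n
        using g_le_f[of n y] by (smt (verit))
      then show ?thesis
        unfolding f_def[of x] by (intro cSUP_least) auto
    qed
    show "\<exists>K. compactin mtopology K \<and> (\<forall>x\<in>M - K. f x < \<epsilon>)" if "0 < \<epsilon>" for \<epsilon>
    proof -
      obtain m where m: "(1/2::real) ^ m < \<epsilon>"
        using real_arch_pow_inv[OF \<open>0 < \<epsilon>\<close>, of "1/2"] by auto
      let ?K = "\<Union>n<m. mcball (c n) (r n)"
      have "f x < \<epsilon>" if x: "x \<in> M - ?K" for x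
      proof -
        have "g n x \<le> (1/2) ^ m" for n
        proof (cases "n < m")
          case True
          then have "x \<notin> mcball (c n) (r n)"
            using x by blast
          then have "g n x = 0"
            using x by (auto simp: g_def)
          then show ?thesis
            by simp
        next
          case False
          then have "(1/2::real) ^ n \<le> (1/2) ^ m"
            by (intro power_decreasing) auto
          then show ?thesis
            using g_le[of n x] by linarith
        qed
        then have "f x \<le> (1/2) ^ m"
          unfolding f_def by (intro cSUP_least) auto
        then show ?thesis
          using m by linarith
      qed
      moreover have "compactin mtopology ?K"
        using compact by (intro compactin_Union) auto
      ultimately show ?thesis
        by blast
    qed
  qed
qed

text \<open>
  A path from \<open>x\<close> to \<open>y\<close> may run directly or through a point at infinity whose distance to \<open>x\<close>
  is \<open>f x\<close>. The Lipschitz condition is the triangle inequality for a direct step followed by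
  a step to infinity. Since \<open>f x > 0\<close>, the shortcut does not help within distance \<open>f x\<close> of \<open>x\<close>,
  so small balls, and with them the topology, are unchanged.
\<close>

lemma shortcut_metric:
  assumes nonneg: "\<And>x. 0 \<le> f x" and pos: "\<And>x. x \<in> M \<Longrightarrow> 0 < f x"
    and Lipschitz: "\<And>x y. \<lbrakk>x \<in> M; y \<in> M\<rbrakk> \<Longrightarrow> f x \<le> f y + d x y"
  defines "d' \<equiv> \<lambda>x y. min (d x y) (f x + f y)"
  shows "Metric_space M d'" "Metric_space.mtopology M d' = mtopology"
proof -
  show "Metric_space M d'"
  proof
    show "0 \<le> d' x y" for x y
      using nonneg[of x] nonneg[of y] by (simp add: d'_def)
    show "d' x y = d' y x" for x y
      by (simp add: d'_def commute add.commute)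
    show "(d' x y = 0) = (x = y)" if "x \<in> M" "y \<in> M" for x y
      using pos[OF that(1)] pos[OF that(2)] that by (auto simp: d'_def min_def split: if_splits)
    show "d' x z \<le> d' x y + d' y z" if "x \<in> M" "y \<in> M" "z \<in> M" for x y z
      using triangle[OF that] Lipschitz[of x y] Lipschitz[of z y] that nonneg[of y] commute[of z y]
      by (auto simp: d'_def)
  qed
  then interpret D: Metric_space M d' .
  have d'_le: "d' x y \<le> d x y" for x y
    by (simp add: d'_def)
  have d'_eq: "d' x y = d x y" if "d' x y < f x" for x y
    using that nonneg[of y] by (auto simp: d'_def min_def split: if_splits)
  show "D.mtopology = mtopology"
  proof (rule topology_eq[THEN iffD2], intro allI iffI)
    fix U assume U: "openin D.mtopology U"
    have "\<exists>e>0. mball x e \<subseteq> U" if "x \<in> U" for x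
    proof -
      obtain e where e: "0 < e" "D.mball x e \<subseteq> U"
        using U \<open>x \<in> U\<close> by (auto simp: D.openin_mtopology)
      moreover have "mball x e \<subseteq> D.mball x e"
        by (auto intro: le_less_trans[OF d'_le])
      ultimately show ?thesis
        by blast
    qed
    then show "openin mtopology U"
      using U by (auto simp: D.openin_mtopology openin_mtopology)
  next
    fix U assume U: "openin mtopology U"
    have "\<exists>e>0. D.mball x e \<subseteq> U" if "x \<in> U" for x
    proof -
      obtain e where e: "0 < e" "mball x e \<subseteq> U"
        using U \<open>x \<in> U\<close> by (auto simp: openin_mtopology)
      have "x \<in> M"
        using U that by (auto simp: openin_mtopology)
      then have "0 < min e (f x)"
        using e pos by simp
      moreover have "D.mball x (min e (f x)) \<subseteq> mball x e"
      proof
        fix y assume "y \<in> D.mball x (min e (f x))"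
        then show "y \<in> mball x e"
          using d'_eq[of x y] by auto
      qed
      ultimately show ?thesis
        using e by blast
    qed
    then show "openin D.mtopology U"
      using U by (auto simp: D.openin_mtopology openin_mtopology)
  qed
qed

end

lemma metric_small_outside_compacta:
  assumes "locally_compact_space X" "separable_space X" "metrizable_space X"
  obtains d where "metric_inducing X d"
    "\<And>\<epsilon>. 0 < \<epsilon> \<Longrightarrow>
      \<exists>K. compactin X K \<and> (\<forall>x\<in>topspace X - K. \<forall>y\<in>topspace X - K. d x y < \<epsilon>)"
proof -
  obtain M \<rho> where M: "Metric_space M \<rho>" and X: "X = Metric_space.mtopology M \<rho>"
    using assms(3) unfolding metrizable_space_def by blast
  interpret Metric_space M \<rho>
    by (rule M)
  have top: "topspace X = M"
    by (simp add: X)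
  obtain f where f: "\<And>x. 0 \<le> f x" "\<And>x. x \<in> M \<Longrightarrow> 0 < f x"
      "\<And>x y. \<lbrakk>x \<in> M; y \<in> M\<rbrakk> \<Longrightarrow> f x \<le> f y + \<rho> x y"
    and small: "\<And>\<epsilon>. 0 < \<epsilon> \<Longrightarrow> \<exists>K. compactin mtopology K \<and> (\<forall>x\<in>M - K. f x < \<epsilon>)"
    using Lipschitz_function_vanishing_at_infinity assms(1,2) unfolding X by metis
  define d where "d x y = min (\<rho> x y) (f x + f y)" for x y
  show thesis
  proof
    show "metric_inducing X d"
      unfolding metric_inducing_def top d_def[abs_def]
      using shortcut_metric[of f, OF f] by (simp add: X)
    fix \<epsilon> :: real assume "0 < \<epsilon>"
    then obtain K where K: "compactin mtopology K" "\<forall>x\<in>M - K. f x < \<epsilon>/2"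
      using small[of "\<epsilon>/2"] by auto
    have "d x y < \<epsilon>" if "x \<in> M - K" "y \<in> M - K" for x y
      using K(2)[rule_format, OF that(1)] K(2)[rule_format, OF that(2)] by (simp add: d_def)
    then show "\<exists>K. compactin X K \<and> (\<forall>x\<in>topspace X - K. \<forall>y\<in>topspace X - K. d x y < \<epsilon>)"
      using K(1) by (intro exI[of _ K]) (simp add: top X)
  qed
qed

section \<open>Almost periodicity\<close>

lemma homeomorphic_map_imp_bij_betw:
  assumes "homeomorphic_map X Y h"
  shows "bij_betw h (topspace X) (topspace Y)"
  using assms by (simp add: bij_betw_def homeomorphic_imp_injective_map homeomorphic_imp_surjective_map)

lemma metric_inducing_subtopology:
  assumes "metric_inducing X d" "A \<subseteq> topspace X"
  shows "metric_inducing (subtopology X A) d"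
proof -
  interpret Submetric "topspace X" d A
    using assms by (simp add: Submetric_def Submetric_axioms_def metric_inducing_def)
  have "topspace (subtopology X A) = A"
    using assms(2) by auto
  then show ?thesis
    using assms mtopology_submetric sub.Metric_space_axioms by (simp add: metric_inducing_def)
qed

lemma almost_periodic_homeo_subset:
  assumes d: "metric_inducing X d" and ap: "almost_periodic_homeo (topspace X) d h"
    and A: "A \<subseteq> topspace X" "h ` A = A"
  shows "almost_periodic_homeo A d h"
proof -
  have X: "Metric_space.mtopology (topspace X) d = X"
    and dA: "Metric_space A d" "Metric_space.mtopology A d = subtopology X A"
    using d metric_inducing_subtopology[OF d A(1)] A(1)
    by (auto simp: metric_inducing_def inf_absorb2)
  have h: "homeomorphic_map X X h"
    using ap X by (simp add: almost_periodic_homeo_def)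
  have bij: "bij_betw h (topspace X) (topspace X)"
    using h by (rule homeomorphic_map_imp_bij_betw)
  have "homeomorphic_map (subtopology X A) (subtopology X A) h"
    using h A by (intro homeomorphic_map_subtopologies) (auto simp: inf_absorb2)
  moreover have "iterate A h i x = iterate (topspace X) h i x" if "x \<in> A" for i x
    using iterate_restrict[OF bij A that] .
  then have "\<exists>N\<ge>0. \<forall>M. \<exists>i\<ge>M. i \<le> M + N \<and> (\<forall>x\<in>A. d (iterate A h i x) x < \<epsilon>)"
    if "0 < \<epsilon>" for \<epsilon>
    using ap A(1) that unfolding almost_periodic_homeo_def by (smt (verit) subsetD)
  ultimately show ?thesis
    using dA by (simp add: almost_periodic_homeo_def)
qed

text \<open>
  A return to within \<open>r\<close> of the starting point puts the orbit in a fixed compact neighbourhood of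
  \<open>B\<close>. From the last such return up to time \<open>n\<close> at most \<open>N\<close> further steps are made.
\<close>

lemma almost_periodic_orbit_closure_compact:
  assumes lc: "locally_compact_space X" and d: "metric_inducing X d"
    and ap: "almost_periodic_homeo (topspace X) d h" and B: "compactin X B"
  shows "compactin X (X closure_of (\<Union>n. iterate (topspace X) h n ` B))"
proof -
  interpret Metric_space "topspace X" d
    using d by (simp add: metric_inducing_def)
  have X: "mtopology = X"
    using d by (simp add: metric_inducing_def)
  have h: "homeomorphic_map X X h"
    using ap X by (simp add: almost_periodic_homeo_def)
  have bij: "bij_betw h (topspace X) (topspace X)"
    using h by (rule homeomorphic_map_imp_bij_betw)
  have BX: "B \<subseteq> topspace X"
    using B by (rule compactin_subset_topspace)
  obtain r K where r: "0 < r" and K: "compactin X K"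
    and nbhd: "\<And>x y. \<lbrakk>x \<in> B; y \<in> topspace X; d x y < r\<rbrakk> \<Longrightarrow> y \<in> K"
    using locally_compact_obtain_uniform_nbhd[of B] lc B unfolding X by metis
  obtain N where N: "\<And>M::int. \<exists>i. M \<le> i \<and> i \<le> M + N \<and>
      (\<forall>x\<in>topspace X. d (iterate (topspace X) h i x) x < r)"
    using ap r unfolding almost_periodic_homeo_def by blast
  define C where "C = (\<Union>j\<le>nat N. (h ^^ j) ` K)"
  have "(\<Union>n. iterate (topspace X) h n ` B) \<subseteq> C"
  proof clarify
    fix n x assume x: "x \<in> B"
    then have xX: "x \<in> topspace X"
      using BX by blast
    (* the return time is sought in the window [n - N, n], so that n - i lies in [0, N] *)
    obtain i where i: "n - N \<le> i" "i \<le> n" "d (iterate (topspace X) h i x) x < r"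
      using N[of "n - N"] xX by auto
    have "iterate (topspace X) h i x \<in> K"
      using nbhd[OF x] iterate_mem[OF bij xX] i(3) by (simp add: commute)
    moreover have "iterate (topspace X) h n x = (h ^^ nat (n - i)) (iterate (topspace X) h i x)"
      using iterate_add_nat[OF bij xX, of i "nat (n - i)"] i(2) by simp
    ultimately show "iterate (topspace X) h n x \<in> C"
      using i(1) unfolding C_def by (intro UN_I[of "nat (n - i)"]) auto
  qed
  moreover have "compactin X ((h ^^ j) ` K)" for j
  proof (induction j)
    case (Suc j)
    then have "compactin X (h ` (h ^^ j) ` K)"
      using h homeomorphic_imp_continuous_map image_compactin by blast
    then show ?case
      by (simp add: image_comp)
  qed (use K in simp)
  then have "compactin X C"
    unfolding C_def by (intro compactin_Union) auto
  moreover have "Hausdorff_space X"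
    using Hausdorff_space_mtopology by (simp add: X)
  ultimately show ?thesis
    by (meson closed_compactin closedin_closure_of closure_of_minimal compactin_imp_closedin)
qed

text \<open>
  The orbit of \<open>B\<close> is mapped onto itself because every integer is the successor of an integer,
  and a homeomorphism commutes with closure.
\<close>

lemma image_orbit_closure:
  assumes h: "homeomorphic_map X X h" and B: "B \<subseteq> topspace X"
  defines "K \<equiv> X closure_of (\<Union>n. iterate (topspace X) h n ` B)"
  shows "h ` K = K"
proof -
  let ?O = "\<Union>n. iterate (topspace X) h n ` B"
  have bij: "bij_betw h (topspace X) (topspace X)"
    using h by (rule homeomorphic_map_imp_bij_betw)
  have succ: "h (iterate (topspace X) h n x) = iterate (topspace X) h (n + 1) x" if "x \<in> B" for n x
    using iterate_succ[OF bij] B that by (metis subsetD)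
  have "h ` ?O = ?O"
  proof
    show "h ` ?O \<subseteq> ?O"
      using succ by fastforce
    show "?O \<subseteq> h ` ?O"
    proof clarify
      fix n x assume "x \<in> B"
      then have "iterate (topspace X) h n x = h (iterate (topspace X) h (n - 1) x)"
        using succ[of x "n - 1"] by simp
      then show "iterate (topspace X) h n x \<in> h ` ?O"
        using \<open>x \<in> B\<close> by blast
    qed
  qed
  moreover have "?O \<subseteq> topspace X"
    using iterate_mem[OF bij] B by blast
  ultimately show ?thesis
    unfolding K_def using homeomorphic_map_closure_of[OF h, of ?O] by simp
qed

text \<open>
  This is uniform continuity of the identity of \<open>Y\<close>, and it is why almost periodicity on a
  compact set can be moved from one metric to another.
\<close>

lemma compact_metrics_uniformly_equivalent:
  assumes d1: "metric_inducing Y d1" and d2: "metric_inducing Y d2" and "compact_space Y"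
    and "0 < \<epsilon>"
  obtains \<delta> where "0 < \<delta>"
    "\<And>x y. \<lbrakk>x \<in> topspace Y; y \<in> topspace Y; d1 x y < \<delta>\<rbrakk> \<Longrightarrow> d2 x y < \<epsilon>"
proof -
  interpret D1: Metric_space "topspace Y" d1
    using d1 by (simp add: metric_inducing_def)
  interpret D2: Metric_space "topspace Y" d2
    using d2 by (simp add: metric_inducing_def)
  have "uniformly_continuous_map D1.Self D2.Self (\<lambda>x. x)"
    using d1 d2 assms(3) 
    by (intro continuous_imp_uniformly_continuous_map)
      (simp_all add: metric_inducing_def mtopology_of_def D1.mspace_Self)
  then show thesis
    using that \<open>0 < \<epsilon>\<close> unfolding uniformly_continuous_map_def by fastforce
qed

text \<open>
  The metric may be chosen before \<open>h\<close> is known: invariance under \<open>h\<close> enters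
  only through the compact set \<open>K\<close>, the orbit closure of a compact set with small complement.
\<close>

lemma compactly_almost_periodic_imp_almost_periodic:
  assumes d: "metric_inducing X d"
    and small: "\<And>\<epsilon>. 0 < \<epsilon> \<Longrightarrow>
      \<exists>K. compactin X K \<and> (\<forall>x\<in>topspace X - K. \<forall>y\<in>topspace X - K. d x y < \<epsilon>)"
    and cap: "compactly_almost_periodic X h"
  shows "almost_periodic_homeo (topspace X) d h"
proof -
  let ?it = "iterate (topspace X) h"
  have h: "homeomorphic_map X X h"
    using cap by (simp add: compactly_almost_periodic_def)
  have bij: "bij_betw h (topspace X) (topspace X)"
    using h by (rule homeomorphic_map_imp_bij_betw)
  have "\<exists>N\<ge>0. \<forall>M. \<exists>i\<ge>M. i \<le> M + N \<and> (\<forall>x\<in>topspace X. d (?it i x) x < \<epsilon>)"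
    if \<epsilon>: "0 < \<epsilon>" for \<epsilon>
  proof -
    obtain B where B: "compactin X B"
      and small_B: "\<And>x y. \<lbrakk>x \<in> topspace X - B; y \<in> topspace X - B\<rbrakk> \<Longrightarrow> d x y < \<epsilon>"
      using small[OF \<epsilon>] by blast
    have BX: "B \<subseteq> topspace X"
      using B by (rule compactin_subset_topspace)
    define K where "K = X closure_of (\<Union>n. ?it n ` B)"
    have K: "compactin X K"
      using cap B by (simp add: compactly_almost_periodic_def K_def)
    have KX: "K \<subseteq> topspace X"
      using K by (rule compactin_subset_topspace)
    have hK: "h ` K = K"
      unfolding K_def using h BX by (rule image_orbit_closure)
    have "B = ?it 0 ` B"
      by (simp add: image_def)
    then have "B \<subseteq> (\<Union>n. ?it n ` B)"
      by blast
    moreover have "(\<Union>n. ?it n ` B) \<subseteq> topspace X"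
      using iterate_mem[OF bij] BX by blast
    ultimately have BK: "B \<subseteq> K"
      unfolding K_def using closure_of_subset by blast
    have itK: "iterate K h i x = ?it i x" "?it i x \<in> K" if "x \<in> K" for i x
    proof -
      have "bij_betw h K K"
        using bij_betw_subset[OF bij KX hK] .
      then show "iterate K h i x = ?it i x" "?it i x \<in> K"
        using iterate_restrict[OF bij KX hK that] iterate_mem that by metis+
    qed
    have it_notin: "?it i x \<notin> K" if x: "x \<in> topspace X - K" for i x
    proof -
      have h_compl: "h ` (topspace X - K) = topspace X - K"
        using inj_on_image_set_diff[of h "topspace X" "topspace X" K] bij hK KX
        by (simp add: bij_betw_def)
      have "bij_betw h (topspace X - K) (topspace X - K)"
        using bij_betw_subset[OF bij Diff_subset h_compl] .
      then show ?thesis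
        using iterate_mem[OF _ x, of h i] iterate_restrict[OF bij Diff_subset h_compl x, of i]
        by simp
    qed
    obtain d' where d': "metric_inducing (subtopology X K) d'" "almost_periodic_homeo K d' h"
      using cap K hK unfolding compactly_almost_periodic_def by blast
    obtain \<delta> where \<delta>: "0 < \<delta>" "\<And>x y. \<lbrakk>x \<in> K; y \<in> K; d' x y < \<delta>\<rbrakk> \<Longrightarrow> d x y < \<epsilon>"
      using compact_metrics_uniformly_equivalent[OF d'(1) metric_inducing_subtopology[OF d KX] _ \<epsilon>]
        K KX by (metis compactin_subspace inf.absorb2 topspace_subtopology)
    obtain N where N: "0 \<le> N" "\<And>M::int. \<exists>i. M \<le> i \<and> i \<le> M + N \<and>
        (\<forall>x\<in>K. d' (iterate K h i x) x < \<delta>)"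
      using d'(2) \<delta>(1) unfolding almost_periodic_homeo_def by blast
    have "\<exists>i\<ge>M. i \<le> M + N \<and> (\<forall>x\<in>topspace X. d (?it i x) x < \<epsilon>)" for M
    proof -
      obtain i where i: "M \<le> i" "i \<le> M + N" "\<forall>x\<in>K. d' (iterate K h i x) x < \<delta>"
        using N(2) by blast
      have "d (?it i x) x < \<epsilon>" if x: "x \<in> topspace X" for x
      proof (cases "x \<in> K")
        case True
        then show ?thesis
          using \<delta>(2) itK i(3) by metis
      next
        case False
        then have "?it i x \<in> topspace X - K"
          using it_notin iterate_mem[OF bij] x by blast
        then show ?thesis
          using small_B BK x False by blast
      qed
      then show ?thesis
        using i by blast
    qed
    then show ?thesis
      using N(1) by blast
  qed
  then show ?thesis
    using d h by (simp add: almost_periodic_homeo_def metric_inducing_def)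
qed

theorem theorem4:
  fixes X :: "'a topology" and h :: "'a \<Rightarrow> 'a"
  assumes "locally_compact_space X"
    and "separable_space X"
    and "metrizable_space X"
    and "homeomorphic_map X X h"
  shows "compactly_almost_periodic X h \<longleftrightarrow>
    (\<exists>d. metric_inducing X d \<and> almost_periodic_homeo (topspace X) d h)"
proof
  assume "compactly_almost_periodic X h"
  then show "\<exists>d. metric_inducing X d \<and> almost_periodic_homeo (topspace X) d h"
    using metric_small_outside_compacta[OF assms(1-3)]
      compactly_almost_periodic_imp_almost_periodic by metis
next
  assume "\<exists>d. metric_inducing X d \<and> almost_periodic_homeo (topspace X) d h"
  then obtain d where d: "metric_inducing X d" and ap: "almost_periodic_homeo (topspace X) d h"
    by blast
  have "\<exists>d. metric_inducing (subtopology X A) d \<and> almost_periodic_homeo A d h"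
    if "compactin X A" "h ` A = A" for A
  proof -
    have "A \<subseteq> topspace X"
      using that(1) by (rule compactin_subset_topspace)
    then show ?thesis
      using metric_inducing_subtopology[OF d] almost_periodic_homeo_subset[OF d ap] that(2)
      by (intro exI[of _ d]) simp
  qed
  then show "compactly_almost_periodic X h"
    using assms(3,4) almost_periodic_orbit_closure_compact[OF assms(1) d ap]
    by (simp add: compactly_almost_periodic_def)
qed

end
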